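(* If a polyhedron (strictly-convex Euclidean realization of a polyhedral graph) has fewer than $9$ vertices, then all of its vertices are rigid.
   Context: A polyhedral graph is a planar graph given by the $1$-skeleton of a strictly-convex Euclidean (3-dimensional) polyhedron; equivalently (Steinitz) it is a 3-connected planar graph with no loops and no multiple edges. A polyhedron means a strictly-convex Euclidean realization of a polyhedral graph. The non-triangular degree of a vertex $v$ is the number of non-triangular faces adjacent to (i.e. incident with) $v$. A vertex is (combinatorially) rigid if its non-triangular degree is at most $3$. *)

theory Defs
  imports "HOL-Analysis.Analysis"
begin

(* A polyhedron is a full-dimensional convex polytope in Euclidean 3-space; the
   library constant polyhedron would also admit unbounded and lower-dimensional
   sets.  The underlying polyhedral graph is its 1-skeleton: by Steinitz's theorem
   every polyhedral graph arises this way, and its faces are the facets. *)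
definition convex_polyhedron :: "(real^3) set \<Rightarrow> bool" where
  "convex_polyhedron P \<longleftrightarrow> polytope P \<and> aff_dim P = 3"

definition vertices :: "(real^3) set \<Rightarrow> (real^3) set" where
  "vertices P = {v. v extreme_point_of P}"

(* A facet counts as triangular when it is a nondegenerate triangle (a 2-simplex). *)
definition nontriangular_degree :: "(real^3) set \<Rightarrow> real^3 \<Rightarrow> nat" where
  "nontriangular_degree P v = card {F. F facet_of P \<and> v \<in> F \<and> \<not> 2 simplex F}"

definition rigid_vertex :: "(real^3) set \<Rightarrow> real^3 \<Rightarrow> bool" where
  "rigid_vertex P v \<longleftrightarrow> v \<in> vertices P \<and> nontriangular_degree P v \<le> 3"

end

theory Submission
  imports Defs
begin

text \<open>
  Let \<open>v\<close> be a vertex with \<open>k\<close> non-triangular facets, and call a vertex a neighbour of \<open>v\<close> when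
  the segment joining it to \<open>v\<close> is an edge.  Two counts bound the number of vertices from below.

  Every non-triangular facet at \<open>v\<close> has a diagonal from \<open>v\<close>: at least four vertices lie on the
  facet, and at most two of them are neighbours of \<open>v\<close>.  Two distinct facets meet in a face of
  dimension at most one, so a vertex \<open>w \<noteq> v\<close> common to both is joined to \<open>v\<close> by an edge.
  Hence the far ends of the \<open>k\<close> diagonals are \<open>k\<close> distinct non-neighbours of \<open>v\<close>.

  For the same reason two distinct facets at \<open>v\<close> share at most one neighbour of \<open>v\<close>.  Each
  facet at \<open>v\<close> contains two neighbours, so distinct facets yield distinct pairs of neighbours,
  and \<open>k\<close> is at most \<open>d choose 2\<close>, where \<open>d\<close> is the number of neighbours.

  If \<open>k \<ge> 4\<close>, the second count forces \<open>d \<ge> 4\<close>, and \<open>v\<close> together with four neighbours and four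
  ends of diagonals makes nine vertices.
\<close>

section \<open>Vertices and edges of convex sets\<close>

definition neighbours :: "'a::euclidean_space set \<Rightarrow> 'a \<Rightarrow> 'a set" where
  "neighbours S v = {w. w \<noteq> v \<and> closed_segment v w face_of S}"

lemma neighbours_extreme_point:
  assumes "w \<in> neighbours S v"
  shows "w extreme_point_of S"
  using assms extreme_point_of_face[of "closed_segment v w" S w]
  by (auto simp: neighbours_def extreme_point_of_segment)

lemma neighbours_of_face:
  assumes "F face_of S"
  shows "neighbours F v \<subseteq> neighbours S v \<inter> F"
  using face_of_face[OF assms] by (auto simp: neighbours_def)

lemma polytope_dim_le_1_eq_segment:
  fixes E :: "'a::euclidean_space set"
  assumes "polytope E" "aff_dim E \<le> 1"
    and "v extreme_point_of E" "w extreme_point_of E" "v \<noteq> w"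
  shows "E = closed_segment v w"
proof -
  have "E \<noteq> {}" using assms(3) by auto
  then obtain a b where E: "E = closed_segment a b"
    using assms(1,2) compact_convex_collinear_segment collinear_aff_dim
      polytope_imp_compact polytope_imp_convex by metis
  then show ?thesis
    using assms(3-5) by (auto simp: extreme_point_of_segment closed_segment_commute)
qed

lemma convex_diff_face:
  assumes "convex S" "T face_of S"
  shows "convex (S - T)"
  unfolding convex_contains_open_segment
proof (intro ballI)
  fix a b assume ab: "a \<in> S - T" "b \<in> S - T"
  then have "open_segment a b \<subseteq> S"
    using assms(1) by (auto simp: convex_contains_open_segment)
  then show "open_segment a b \<subseteq> S - T"
    using assms(2) ab by (auto simp: face_of_def)
qed

text \<open>
  Removing a face from a convex set leaves a convex set.  So if a point of \<open>convex hull M\<close> were in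
  \<open>convex hull N\<close>, some element of \<open>N\<close> would lie in the face, where the only extreme points
  are those in \<open>M\<close>.
\<close>
lemma face_hull_disjoint_hull:
  fixes S :: "'a::euclidean_space set"
  assumes "convex S" "convex hull M face_of S"
    and ext: "\<And>x. x \<in> N \<Longrightarrow> x extreme_point_of S" and "M \<inter> N = {}"
  shows "convex hull M \<inter> convex hull N = {}"
proof -
  have "x \<notin> convex hull M" if "x \<in> N" for x
    using that ext extreme_point_of_face[OF assms(2)] extreme_point_of_convex_hull assms(4)
    by blast
  then have "N \<subseteq> S - convex hull M"
    using ext by (auto simp: extreme_point_of_def)
  then have "convex hull N \<subseteq> S - convex hull M"
    using assms(1,2) by (simp add: hull_minimal convex_diff_face)
  then show ?thesis by blast
qed

section \<open>Vertices of a polygon\<close>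

text \<open>
  Four coplanar points \<open>v, a, b, c\<close> have a Radon partition.  If they are extreme and \<open>a, b, c\<close> are
  neighbours of \<open>v\<close>, one part of any partition into two spans a face (the empty set, a vertex,
  or an edge at \<open>v\<close>), so the two hulls are disjoint, contrary to Radon.
\<close>
lemma at_most_two_neighbours_in_plane:
  fixes S :: "'a::euclidean_space set"
  assumes "convex S" "aff_dim S \<le> 2" "v extreme_point_of S"
    and N: "a \<in> neighbours S v" "b \<in> neighbours S v" "c \<in> neighbours S v"
    and "a \<noteq> b" "b \<noteq> c" "a \<noteq> c"
  shows False
proof -
  let ?C = "{v, a, b, c}"
  have ext: "x extreme_point_of S" if "x \<in> ?C" for x
    using that assms(3) N neighbours_extreme_point by auto
  then have "?C \<subseteq> S" by (auto simp: extreme_point_of_def)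
  then have "aff_dim ?C \<le> 2" using aff_dim_subset assms(2) order_trans by blast
  moreover have "card ?C = 4" using assms(7-9) N by (auto simp: neighbours_def)
  ultimately have "affine_dependent ?C"
    using aff_dim_affine_independent[of ?C] by fastforce
  then obtain M P where MP: "M \<inter> P = {}" "M \<union> P = ?C" "convex hull M \<inter> convex hull P \<noteq> {}"
    using Radon_partition[of ?C] by auto
  have hull_face: "convex hull {} face_of S"
    "\<And>x. x \<in> ?C \<Longrightarrow> convex hull {x} face_of S"
    "\<And>x. x \<in> {a, b, c} \<Longrightarrow> convex hull {v, x} face_of S"
    using ext N by (auto simp: face_of_singleton neighbours_def segment_convex_hull)
  have face_or: "convex hull A face_of S \<or> convex hull B face_of S"
    if vA: "v \<in> A" and AB: "A \<inter> B = {}" "A \<union> B = ?C" for A B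
  proof (cases "\<exists>x\<in>{a, b, c}. A \<subseteq> {v, x}")
    case True
    then obtain x where x: "x \<in> {a, b, c}" "A \<subseteq> {v, x}" by (elim bexE)
    then have "A = {v} \<or> A = {v, x}" using vA by blast
    then show ?thesis using hull_face(2)[of v] hull_face(3)[OF x(1)] by auto
  next
    case False
    have "A \<subseteq> ?C" "B \<subseteq> ?C - A" using AB by blast+
    then have "B \<subseteq> {a} \<or> B \<subseteq> {b} \<or> B \<subseteq> {c}" using False vA by auto
    then show ?thesis using hull_face(1) hull_face(2)[of a] hull_face(2)[of b] hull_face(2)[of c]
      by (auto simp: subset_singleton_iff)
  qed
  have "convex hull M face_of S \<or> convex hull P face_of S"
    using face_or[of M P] face_or[of P M] MP(1,2) by blast
  then show False
    using face_hull_disjoint_hull[OF assms(1), of M P] face_hull_disjoint_hull[OF assms(1), of P M]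
      ext MP by blast
qed

text \<open>
  A vertex is the intersection of the sides containing it.  A single side is one-dimensional, so at
  least two sides are needed, and each runs from \<open>v\<close> to a neighbour.
\<close>
lemma two_neighbours_in_polygon:
  fixes F :: "'a::euclidean_space set"
  assumes "polytope F" "aff_dim F = 2" "v extreme_point_of F"
  obtains a b where "a \<in> neighbours F v" "b \<in> neighbours F v" "a \<noteq> b"
proof -
  let ?E = "{E. E facet_of F \<and> {v} \<subseteq> E}"
  have "{v} \<noteq> F" using assms(2) by auto
  then have v: "{v} = \<Inter>?E"
    using face_of_polyhedron[OF polytope_imp_polyhedron[OF assms(1)], of "{v}"] assms(3)
      face_of_singleton by blast
  have side: "\<exists>w \<in> neighbours F v. E = closed_segment v w" if "E \<in> ?E" for E
  proof -
    have E: "E face_of F" "aff_dim E = 1" "v \<in> E"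
      using that assms(2) by (auto simp: facet_of_def)
    have pE: "polytope E" using E(1) assms(1) face_of_polytope_polytope by blast
    have vE: "v extreme_point_of E" using E assms(3) extreme_point_of_face by blast
    have "\<not> {x. x extreme_point_of E} \<subseteq> {v}"
    proof
      assume "{x. x extreme_point_of E} \<subseteq> {v}"
      then have "E \<subseteq> {v}"
        using Krein_Milman_Minkowski[of E] pE polytope_imp_compact polytope_imp_convex
        by (metis convex_hull_singleton hull_mono)
      then show False using aff_dim_subset[of E "{v}"] E(2) by simp
    qed
    then obtain w where "w extreme_point_of E" "w \<noteq> v" by blast
    then have "E = closed_segment v w" "w \<noteq> v"
      using polytope_dim_le_1_eq_segment[OF pE] E(2) vE by auto
    then show ?thesis using E(1) by (auto simp: neighbours_def)
  qed
  have "?E \<noteq> {}"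
  proof
    assume "?E = {}"
    then have "F \<subseteq> {v}" using v by (metis Inf_empty top_greatest)
    then show False using aff_dim_subset[of F "{v}"] assms(2) by simp
  qed
  then obtain E where E: "E \<in> ?E" by blast
  have "\<not> ?E \<subseteq> {E}"
  proof
    assume "?E \<subseteq> {E}"
    then have "?E = {E}" using E by blast
    then have "{v} = E" using v by (metis Inter_insert Inf_empty inf_top_right)
    then show False using E assms(2) aff_dim_sing[of v] by (auto simp: facet_of_def)
  qed
  then obtain E' where E': "E' \<in> ?E" "E' \<noteq> E" by blast
  then show ?thesis using side[OF E] side[OF E'(1)] that by metis
qed

text \<open>
  A polygon with at most three vertices is a triangle, so some vertex other than \<open>v\<close> and its
  at most two neighbours remains.
\<close>
lemma nontriangle_has_diagonal:
  fixes F :: "'a::euclidean_space set"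
  assumes "polytope F" "aff_dim F = 2" "v extreme_point_of F" "\<not> 2 simplex F"
  obtains d where "d extreme_point_of F" "d \<noteq> v" "d \<notin> neighbours F v"
proof -
  let ?X = "{x. x extreme_point_of F}"
  have fin: "finite ?X"
    using assms(1) finite_polyhedron_extreme_points polytope_imp_polyhedron by blast
  have F: "F = convex hull ?X"
    using Krein_Milman_Minkowski assms(1) polytope_imp_compact polytope_imp_convex by blast
  then have dim: "aff_dim ?X = 2" using assms(2) by (metis aff_dim_convex_hull)
  have "card ?X \<ge> 3" using aff_dim_le_card[OF fin] dim by linarith
  moreover have "card ?X \<noteq> 3"
  proof
    assume "card ?X = 3"
    moreover then have "\<not> affine_dependent ?X"
      using fin dim by (simp add: affine_independent_iff_card)
    ultimately have "2 simplex F" using F unfolding simplex_def by (intro exI[of _ ?X]) simp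
    then show False using assms(4) by contradiction
  qed
  ultimately have "card (?X - {v}) \<ge> 3" using fin assms(3) by simp
  then obtain T where "T \<subseteq> ?X - {v}" "card T = 3" using obtain_subset_with_card_n by metis
  then obtain a b c where abc: "T = {a, b, c}" "a \<noteq> b" "b \<noteq> c" "a \<noteq> c"
    by (auto simp: card_3_iff)
  then have "\<not> T \<subseteq> neighbours F v"
    using at_most_two_neighbours_in_plane[of F v a b c] assms polytope_imp_convex by auto
  then show ?thesis using that \<open>T \<subseteq> ?X - {v}\<close> by blast
qed

section \<open>Facets around a vertex of a three-dimensional polytope\<close>

text \<open>
  The two facets meet in a proper face of one of them, which is at most one-dimensional; having two
  vertices \<open>v\<close> and \<open>w\<close>, it is the edge between them.
\<close>
lemma facets_Int_eq_segment:
  fixes P :: "'a::euclidean_space set"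
  assumes "polytope P" "aff_dim P = 3" "F facet_of P" "G facet_of P" "F \<noteq> G"
    and "v extreme_point_of P" "w extreme_point_of P" "v \<noteq> w" "{v, w} \<subseteq> F \<inter> G"
  shows "F \<inter> G = closed_segment v w"
proof -
  have F: "F face_of P" "aff_dim F = 2" and G: "G face_of P" "aff_dim G = 2"
    using assms(2-4) by (auto simp: facet_of_def)
  have FG: "F \<inter> G face_of P" using F G face_of_Int by blast
  then have sub: "F \<inter> G face_of F" "F \<inter> G face_of G"
    using F G by (meson face_of_face inf_le1 inf_le2)+
  have "F \<inter> G \<noteq> F \<or> F \<inter> G \<noteq> G" using assms(5) by blast
  then have "aff_dim (F \<inter> G) < 2"
    using sub F G face_of_aff_dim_lt face_of_imp_convex by metis
  then show ?thesis
    using polytope_dim_le_1_eq_segment[of "F \<inter> G" v w] assms FG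
      face_of_polytope_polytope extreme_point_of_face[OF FG] by auto
qed

theorem theorem1p2:
  fixes P :: "(real^3) set"
  assumes "convex_polyhedron P"
    and "card (vertices P) < 9"
  shows "\<forall>v \<in> vertices P. rigid_vertex P v"
proof
  fix v assume "v \<in> vertices P"
  then have v: "v extreme_point_of P" by (simp add: vertices_def)
  have P: "polytope P" "aff_dim P = 3" using assms(1) by (auto simp: convex_polyhedron_def)
  let ?K = "{F. F facet_of P \<and> v \<in> F \<and> \<not> 2 simplex F}"
  let ?N = "neighbours P v"
  have finV: "finite (vertices P)"
    unfolding vertices_def using P(1) finite_polyhedron_extreme_points polytope_imp_polyhedron
    by blast
  have N: "?N \<subseteq> vertices P" using neighbours_extreme_point by (auto simp: vertices_def)
  then have finN: "finite ?N" using finV finite_subset by blast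
  have facet: "F face_of P" "polytope F" "aff_dim F = 2" "v extreme_point_of F" if "F \<in> ?K" for F
    using that P v face_of_polytope_polytope
    by (auto simp: facet_of_def extreme_point_of_face)

  \<comment> \<open>The far ends of diagonals: one non-neighbour of \<open>v\<close> for each facet.\<close>
  have "\<exists>d. d \<in> vertices P \<and> d \<in> F \<and> d \<noteq> v \<and> d \<notin> ?N" if FK: "F \<in> ?K" for F
  proof -
    obtain d where d: "d extreme_point_of F" "d \<noteq> v" "d \<notin> neighbours F v"
      using nontriangle_has_diagonal[OF facet(2-4)[OF FK]] FK by blast
    have "d \<in> vertices P" "d \<in> F"
      using d(1) extreme_point_of_face[OF facet(1)[OF FK]] by (auto simp: vertices_def)
    moreover have "closed_segment v d \<subseteq> F"
      using \<open>d \<in> F\<close> FK facet(2)[OF FK] by (simp add: closed_segment_subset polytope_imp_convex)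
    ultimately show ?thesis
      using d(2,3) face_of_face[OF facet(1)[OF FK]] by (auto simp: neighbours_def)
  qed
  then have "\<exists>d. \<forall>F\<in>?K. d F \<in> vertices P \<and> d F \<in> F \<and> d F \<noteq> v \<and> d F \<notin> ?N"
    by (intro bchoice ballI)
  then obtain d where d: "\<And>F. F \<in> ?K \<Longrightarrow> d F \<in> vertices P \<and> d F \<in> F \<and> d F \<noteq> v \<and> d F \<notin> ?N"
    by blast
  have "inj_on d ?K"
  proof (rule inj_onI, rule ccontr)
    fix F G assume FG: "F \<in> ?K" "G \<in> ?K" "d F = d G" "F \<noteq> G"
    then have "F \<inter> G = closed_segment v (d F)"
      using facets_Int_eq_segment[OF P, of F G v "d F"] d[of F] d[of G] v
      by (auto simp: vertices_def)
    then have "closed_segment v (d F) face_of P"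
      using face_of_Int[OF facet(1)[OF FG(1)] facet(1)[OF FG(2)]] by simp
    then show False using d[OF FG(1)] by (simp add: neighbours_def)
  qed
  then have card_d: "card (d ` ?K) = card ?K" by (rule card_image)

  \<comment> \<open>A pair of neighbours of \<open>v\<close> determines the facet, which bounds the number of facets.\<close>
  have "\<exists>T. T \<subseteq> ?N \<inter> F \<and> card T = 2" if FK: "F \<in> ?K" for F
  proof -
    obtain a b where "a \<in> neighbours F v" "b \<in> neighbours F v" "a \<noteq> b"
      using two_neighbours_in_polygon[OF facet(2-4)[OF FK]] by blast
    then have "{a, b} \<subseteq> ?N \<inter> F" "card {a, b} = 2"
      using neighbours_of_face[OF facet(1)[OF FK]] by auto
    then show ?thesis by blast
  qed
  then have "\<exists>T. \<forall>F\<in>?K. T F \<subseteq> ?N \<inter> F \<and> card (T F) = 2"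
    by (intro bchoice ballI)
  then obtain T where T: "\<And>F. F \<in> ?K \<Longrightarrow> T F \<subseteq> ?N \<inter> F \<and> card (T F) = 2" by blast
  have "inj_on T ?K"
  proof (rule inj_onI, rule ccontr)
    fix F G assume FG: "F \<in> ?K" "G \<in> ?K" "T F = T G" "F \<noteq> G"
    obtain a b where ab: "T F = {a, b}" "a \<noteq> b" using T[OF FG(1)] by (auto simp: card_2_iff)
    have "F \<inter> G = closed_segment v x" if "x \<in> {a, b}" for x
    proof -
      have "x \<in> ?N" "x \<in> F \<inter> G"
        using that ab T[OF FG(1)] T[OF FG(2)] FG(3) by blast+
      then have "x extreme_point_of P" "v \<noteq> x" "{v, x} \<subseteq> F \<inter> G"
        using neighbours_extreme_point FG(1,2) by (auto simp: neighbours_def)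
      then show ?thesis using facets_Int_eq_segment[OF P] FG(1,2,4) v by blast
    qed
    then have "closed_segment v a = closed_segment v b" by blast
    then have "b = v \<or> b = a"
      using extreme_point_of_segment[of b v a] extreme_point_of_segment[of b v b] by metis
    then show False using ab T[OF FG(1)] by (auto simp: neighbours_def)
  qed
  then have "card ?K \<le> card {T. T \<subseteq> ?N \<and> card T = 2}"
    using T finN by (intro card_inj_on_le[of T]) auto
  then have K_choose: "card ?K \<le> card ?N choose 2" using n_subsets[OF finN] by simp

  have "card ?K \<le> 3"
  proof (rule ccontr)
    assume K: "\<not> card ?K \<le> 3"
    have "card ?N \<ge> 4"
    proof (rule ccontr)
      assume "\<not> card ?N \<ge> 4"
      then have "card ?N choose 2 \<le> 3 choose 2" by (intro binomial_right_mono) simp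
      then show False using K_choose K by (simp add: choose_two)
    qed
    moreover have "finite (d ` ?K)" using card_d K by (intro card_ge_0_finite) linarith
    moreover have "?N \<inter> d ` ?K = {}" "v \<notin> ?N \<union> d ` ?K"
      using d by (auto simp: neighbours_def)
    ultimately have "card (insert v (?N \<union> d ` ?K)) \<ge> 9"
      using finN card_d K by (simp add: card_Un_disjoint del: mem_Collect_eq)
    moreover have "insert v (?N \<union> d ` ?K) \<subseteq> vertices P"
      using N d \<open>v \<in> vertices P\<close> by auto
    ultimately show False using card_mono[OF finV] assms(2) by (meson leD order_trans)
  qed
  then show "rigid_vertex P v"
    using \<open>v \<in> vertices P\<close> by (simp add: rigid_vertex_def nontriangular_degree_def)
qed

end
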